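(* For all integers $a,b,c,d \geq 1$, the following identity of formal power series in $t$ with coefficients in $\mathbb{Z}[x]$ holds: $$\begin{aligned} Q_{132}^{(a,b,c,d)}(t,x) ={}& \sum_{p=0}^{b+d-1} C_p t^p + t\sum_{i=0}^{b-2} C_i t^i \left( Q_{132}^{(a,b-1-i,c,d)}(t,x) - \sum_{r=0}^{b-i+d-2} C_rt^r \right) \\ &+ t \left( Q_{132}^{(a-1,b,c,0)}(t,x) - \sum_{i=0}^{b-2} C_i t^i\right) \left( Q_{132}^{(a,0,c,d)}(t,x) - \sum_{j=0}^{d-1} C_j t^j \right) \\ &+ t\sum_{j=0}^{d-1} C_j t^j \left( Q_{132}^{(a-1,b,c,d-j)}(t,x) - \sum_{s=0}^{b+d-j-2} C_st^s\right). \end{aligned}$$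
   Context: Let $\mathbb{N}=\{0,1,2,\ldots\}$. $S_n$ is the set of permutations $\sigma=\sigma_1\ldots\sigma_n$ of $\{1,\ldots,n\}$ in one-line notation, and $S_n(132)$ is the set of $\sigma\in S_n$ that avoid the pattern $132$, i.e. for which there are no indices $i<j<k$ with $\sigma_i<\sigma_k<\sigma_j$. For $a,b,c,d\in\mathbb{N}$, $\sigma_i$ matches the quadrant marked mesh pattern $\mathrm{MMP}(a,b,c,d)$ in $\sigma$ if all of the following hold: there are at least $a$ indices $j>i$ with $\sigma_j>\sigma_i$; at least $b$ indices $j<i$ with $\sigma_j>\sigma_i$; at least $c$ indices $j<i$ with $\sigma_j<\sigma_i$; and at least $d$ indices $j>i$ with $\sigma_j<\sigma_i$. Let $\mathrm{mmp}^{(a,b,c,d)}(\sigma)$ be the number of $i$ such that $\sigma_i$ matches $\mathrm{MMP}(a,b,c,d)$ in $\sigma$. For $n\ge 1$ put $Q_{n,132}^{(a,b,c,d)}(x)=\sum_{\sigma\in S_n(132)}x^{\mathrm{mmp}^{(a,b,c,d)}(\sigma)}$, and $Q_{132}^{(a,b,c,d)}(t,x)=1+\sum_{n\ge1}t^nQ_{n,132}^{(a,b,c,d)}(x)$. $C_n=\frac{1}{n+1}\binom{2n}{n}$ is the $n$-th Catalan number. Empty sums are $0$. *)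

theory Defs
  imports
    "HOL-Computational_Algebra.Computational_Algebra"
    "HOL-Combinatorics.Combinatorics"
begin

definition avoids_132 :: "nat \<Rightarrow> (nat \<Rightarrow> nat) \<Rightarrow> bool" where
  "avoids_132 n \<sigma> \<longleftrightarrow>
     \<not> (\<exists>i j k. 1 \<le> i \<and> i < j \<and> j < k \<and> k \<le> n \<and> \<sigma> i < \<sigma> k \<and> \<sigma> k < \<sigma> j)"

definition S_132 :: "nat \<Rightarrow> (nat \<Rightarrow> nat) set" where
  "S_132 n = {\<sigma>. \<sigma> permutes {1..n} \<and> avoids_132 n \<sigma>}"

definition matches_MMP ::
  "nat \<Rightarrow> nat \<Rightarrow> nat \<Rightarrow> nat \<Rightarrow> nat \<Rightarrow> (nat \<Rightarrow> nat) \<Rightarrow> nat \<Rightarrow> bool" where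
  "matches_MMP a b c d n \<sigma> i \<longleftrightarrow>
     a \<le> card {j\<in>{1..n}. i < j \<and> \<sigma> i < \<sigma> j} \<and>
     b \<le> card {j\<in>{1..n}. j < i \<and> \<sigma> i < \<sigma> j} \<and>
     c \<le> card {j\<in>{1..n}. j < i \<and> \<sigma> j < \<sigma> i} \<and>
     d \<le> card {j\<in>{1..n}. i < j \<and> \<sigma> j < \<sigma> i}"

definition mmp :: "nat \<Rightarrow> nat \<Rightarrow> nat \<Rightarrow> nat \<Rightarrow> nat \<Rightarrow> (nat \<Rightarrow> nat) \<Rightarrow> nat" where
  "mmp a b c d n \<sigma> = card {i\<in>{1..n}. matches_MMP a b c d n \<sigma> i}"

definition Qn_132 :: "nat \<Rightarrow> nat \<Rightarrow> nat \<Rightarrow> nat \<Rightarrow> nat \<Rightarrow> int poly" where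
  "Qn_132 a b c d n = (\<Sum>\<sigma>\<in>S_132 n. monom 1 (mmp a b c d n \<sigma>))"

(* The fps variable is t, the variable of the coefficient polynomials is x. *)
definition Q_132 :: "nat \<Rightarrow> nat \<Rightarrow> nat \<Rightarrow> nat \<Rightarrow> int poly fps" where
  "Q_132 a b c d = Abs_fps (\<lambda>n. if n = 0 then 1 else Qn_132 a b c d n)"

definition catalan :: "nat \<Rightarrow> nat" where
  "catalan n = (2 * n choose n) div (n + 1)"

(* The division in the definition of catalan is exact. *)
lemma Suc_times_catalan: "(n + 1) * catalan n = (2 * n choose n)"
proof -
  have "Suc n * (2 * n choose Suc n) = (2 * n choose n) * n"
    using binomial_absorb_comp[of "2 * n" n] binomial_absorption[of n "2 * n"]
    by (metis diff_add_inverse mult.commute mult_2)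
  then have "(2 * n choose n) + Suc n * (2 * n choose Suc n) = Suc n * (2 * n choose n)"
    by simp
  then have "Suc n dvd (2 * n choose n)"
    by (metis dvd_add_left_iff dvd_triv_left)
  then show ?thesis
    by (metis Suc_eq_plus1 catalan_def dvd_mult_div_cancel)
qed

definition catalan_term :: "nat \<Rightarrow> int poly fps" where
  "catalan_term n = of_nat (catalan n) * fps_X ^ n"

end

theory Submission
  imports Defs
begin

text \<open>
  In a 132-avoiding permutation of size \<open>n + 1\<close>, every entry left of the maximum exceeds every
  entry right of it, since otherwise such a pair together with the maximum would form a 132.
  Hence the permutation is the same thing as a pair of 132-avoiding permutations
  \<open>\<alpha>\<close> of size \<open>i\<close> and \<open>\<beta>\<close> of size \<open>j = n - i\<close>, where \<open>\<alpha>\<close> is shifted up by \<open>j\<close> and stands left of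
  the maximum (\<open>bij_betw_block_join\<close>). From a position of \<open>\<alpha>\<close> one sees, in addition to the rest of
  \<open>\<alpha>\<close>, the maximum in the first quadrant and all \<open>j\<close> entries of \<open>\<beta>\<close> in the fourth; from a position
  of \<open>\<beta>\<close> one sees \<open>i + 1\<close> additional entries, all in the second quadrant; and the maximum has an
  empty first quadrant, so that it does not match when \<open>a \<ge> 1\<close>. This gives (\<open>Qn_132_Suc\<close>), with
  truncated subtraction in the parameters and for \<open>a \<ge> 1\<close>,

    \<open>Q(a, b, c, d)\<^sub>n\<^sub>+\<^sub>1 = (\<Sum>i\<le>n. Q(a - 1, b, c, d - (n - i))\<^sub>i * Q(a, b - 1 - i, c, d)\<^sub>n\<^sub>-\<^sub>i)\<close>.

  A match needs \<open>b + d\<close> entries besides the matching one, so \<open>Q(a, b, c, d)\<^sub>n\<close> is the Catalan number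
  \<open>C\<^sub>n\<close> as long as \<open>n \<le> b + d\<close> (\<open>Qn_132_small\<close>). This explains every Catalan sum in the theorem: the
  first one is the part of degree below \<open>b + d\<close>, and each subtracted one removes an initial segment
  of a generating function. In degree \<open>n + 1 \<ge> b + d\<close> the summands of the recurrence fall into
  three disjoint ranges: \<open>i < b - 1\<close>, where the first factor is \<open>C\<^sub>i\<close>; \<open>j < d\<close>, where the second
  factor is \<open>C\<^sub>j\<close>; and the rest, where the parameters \<open>d - j\<close> and \<open>b - 1 - i\<close> are both truncated
  to 0. They are the three products in the theorem.

  That 132-avoiding permutations are counted by Catalan numbers follows from the same splitting and
  from the quadratic equation for the generating function (\<open>catalan_of_convolution\<close>).
\<close>

section \<open>Splitting a 132-avoiding permutation at its maximum\<close>

text \<open>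
  The one-line notation is \<open>\<alpha>\<close> raised by \<open>j\<close>, then the maximum, then \<open>\<beta>\<close>. Positions outside
  \<open>{1..i + j + 1}\<close> are fixed, as \<open>permutes\<close> demands.
\<close>
definition block_join :: "nat \<Rightarrow> nat \<Rightarrow> (nat \<Rightarrow> nat) \<Rightarrow> (nat \<Rightarrow> nat) \<Rightarrow> nat \<Rightarrow> nat" where
  "block_join i j \<alpha> \<beta> k =
     (if 1 \<le> k \<and> k \<le> i then \<alpha> k + j
      else if k = Suc i then Suc (i + j)
      else if Suc i < k \<and> k \<le> Suc (i + j) then \<beta> (k - Suc i)
      else k)"

lemma block_join_left: "1 \<le> k \<Longrightarrow> k \<le> i \<Longrightarrow> block_join i j \<alpha> \<beta> k = \<alpha> k + j"
  and block_join_max: "block_join i j \<alpha> \<beta> (Suc i) = Suc (i + j)"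
  and block_join_right:
    "1 \<le> m \<Longrightarrow> m \<le> j \<Longrightarrow> block_join i j \<alpha> \<beta> (Suc i + m) = \<beta> m"
  by (auto simp: block_join_def)

lemma permutes_interval_bounds:
  assumes "\<pi> permutes {1..n}" "1 \<le> k" "k \<le> n"
  shows "1 \<le> \<pi> k" "\<pi> k \<le> n"
  using permutes_in_image[OF assms(1), of k] assms(2,3) by auto

lemma block_positions_cases:
  assumes "1 \<le> k" "k \<le> Suc (i + j)"
  obtains "k \<le> i" | "k = Suc i" | m where "k = Suc i + m" "1 \<le> m" "m \<le> j"
proof -
  consider "k \<le> i" | "k = Suc i" | "Suc i < k" by linarith
  then show thesis
  proof cases
    case 3
    then show thesis using that(3)[of "k - Suc i"] assms by simp
  qed (use that in auto)
qed

lemma block_join_permutes: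
  assumes \<alpha>: "\<alpha> permutes {1..i}" and \<beta>: "\<beta> permutes {1..j}"
  shows "block_join i j \<alpha> \<beta> permutes {1..Suc (i + j)}"
proof (rule inj_imp_permutes)
  note bounds = permutes_interval_bounds[OF \<alpha>] permutes_interval_bounds[OF \<beta>]
  note simps = block_join_left block_join_max block_join_right
  show "inj_on (block_join i j \<alpha> \<beta>) {1..Suc (i + j)}"
  proof (rule inj_onI)
    fix k l
    assume k: "k \<in> {1..Suc (i + j)}" and l: "l \<in> {1..Suc (i + j)}"
      and eq: "block_join i j \<alpha> \<beta> k = block_join i j \<alpha> \<beta> l"
    have inj: "\<alpha> x = \<alpha> y \<longleftrightarrow> x = y" "\<beta> x = \<beta> y \<longleftrightarrow> x = y" for x y
      using permutes_inj[OF \<alpha>] permutes_inj[OF \<beta>] by (auto simp: inj_eq)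
    from k have k': "1 \<le> k" "k \<le> Suc (i + j)" by auto
    from l have l': "1 \<le> l" "l \<le> Suc (i + j)" by auto
    from k' show "k = l"
    proof (cases rule: block_positions_cases)
      case 1
      note K = this
      from l' show ?thesis
      proof (cases rule: block_positions_cases)
        case 1
        then show ?thesis using K eq k' l' by (simp add: block_join_left inj)
      next
        case 2
        then show ?thesis
          using K eq k' bounds(2)[of k] by (simp add: block_join_left block_join_max)
      next
        case (3 m)
        then show ?thesis
          using K eq k' bounds(1)[of k] bounds(4)[of m] block_join_right[of m j i \<alpha> \<beta>]
          by (simp add: block_join_left)
      qed
    next
      case 2
      note K = this
      from l' show ?thesis
      proof (cases rule: block_positions_cases)
        case 1
        then show ?thesis
          using K eq l' bounds(2)[of l] by (simp add: block_join_left block_join_max)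
      next
        case 2
        then show ?thesis using K by simp
      next
        case (3 m)
        then show ?thesis
          using K eq bounds(4)[of m] block_join_right[of m j i \<alpha> \<beta>]
          by (simp add: block_join_max)
      qed
    next
      case (3 m)
      note K = this
      from l' show ?thesis
      proof (cases rule: block_positions_cases)
        case 1
        then show ?thesis
          using K eq l' bounds(1)[of l] bounds(4)[of m] block_join_right[of m j i \<alpha> \<beta>]
          by (simp add: block_join_left)
      next
        case 2
        then show ?thesis
          using K eq bounds(4)[of m] block_join_right[of m j i \<alpha> \<beta>]
          by (simp add: block_join_max)
      next
        case (3 m')
        then show ?thesis
          using K eq block_join_right[of m j i \<alpha> \<beta>] block_join_right[of m' j i \<alpha> \<beta>]
          by (simp add: inj)
      qed
    qed
  qed
  show "block_join i j \<alpha> \<beta> k \<in> {1..Suc (i + j)}" if "k \<in> {1..Suc (i + j)}" for k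
  proof -
    from that have k: "1 \<le> k" "k \<le> Suc (i + j)" by auto
    then show ?thesis
    proof (cases rule: block_positions_cases)
      case 1
      then show ?thesis using k bounds(1,2)[of k] by (simp add: block_join_left)
    next
      case 2
      then show ?thesis by (simp add: block_join_max)
    next
      case (3 m)
      then show ?thesis
        using bounds(3,4)[of m] block_join_right[of m j i \<alpha> \<beta>] by simp
    qed
  qed
  show "block_join i j \<alpha> \<beta> k = k" if "k \<notin> {1..Suc (i + j)}" for k
    using that by (auto simp: block_join_def)
qed simp

text \<open>
  The 3 of a 132 lies before the 2 and above it, so the 2 is not the maximum. If the 2 lies in the
  left block, so does the whole pattern. If it lies in the right block, then the smaller 1 does too,
  because the left block is higher, and again the whole pattern lies in one block.
\<close>
lemma block_join_avoids_132:
  assumes \<alpha>: "\<alpha> permutes {1..i}" "avoids_132 i \<alpha>"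
    and \<beta>: "\<beta> permutes {1..j}" "avoids_132 j \<beta>"
  shows "avoids_132 (Suc (i + j)) (block_join i j \<alpha> \<beta>)"
proof -
  let ?f = "block_join i j \<alpha> \<beta>"
  note bounds = permutes_interval_bounds[OF \<alpha>(1)] permutes_interval_bounds[OF \<beta>(1)]
  have False
    if "1 \<le> u" "u < v" "v < w" "w \<le> Suc (i + j)" "?f u < ?f w" "?f w < ?f v" for u v w
  proof -
    from that have w: "1 \<le> w" "w \<le> Suc (i + j)" by auto
    from w show False
    proof (cases rule: block_positions_cases)
      case 1
      with that have "\<alpha> u < \<alpha> w" "\<alpha> w < \<alpha> v" by (simp_all add: block_join_left)
      with \<alpha>(2) that 1 show False unfolding avoids_132_def by blast
    next
      case 2
      with that show False
        using permutes_interval_bounds(2)[OF block_join_permutes[OF \<alpha>(1) \<beta>(1)], of v]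
        by (simp add: block_join_max)
    next
      case (3 m)
      have fw: "?f w = \<beta> m" using block_join_right 3 by simp
      have le: "\<beta> m \<le> j" using 3 bounds(4) by simp
      from that have u: "1 \<le> u" "u \<le> Suc (i + j)" by auto
      have "Suc i < u"
        using u(1) \<open>?f u < ?f w\<close> le fw
        by (cases "u \<le> i"; cases "u = Suc i") (auto simp: block_join_left block_join_max)
      then have "\<beta> (u - Suc i) < \<beta> m" "\<beta> m < \<beta> (v - Suc i)"
        using that 3 fw block_join_right[of "u - Suc i" j i \<alpha> \<beta>]
          block_join_right[of "v - Suc i" j i \<alpha> \<beta>] by simp_all
      moreover have "1 \<le> u - Suc i" "u - Suc i < v - Suc i" "v - Suc i < m" "m \<le> j"
        using \<open>Suc i < u\<close> that 3 by auto
      ultimately show False using \<beta>(2) unfolding avoids_132_def by blast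
    qed
  qed
  then show ?thesis unfolding avoids_132_def by blast
qed

lemma block_join_in_S_132:
  assumes "\<alpha> \<in> S_132 i" "\<beta> \<in> S_132 j"
  shows "block_join i j \<alpha> \<beta> \<in> S_132 (Suc (i + j))"
  using assms block_join_permutes block_join_avoids_132 unfolding S_132_def by blast

lemma block_join_eqD:
  assumes \<alpha>: "\<alpha> permutes {1..i}" "\<alpha>' permutes {1..i}"
    and \<beta>: "\<beta> permutes {1..j}" "\<beta>' permutes {1..j}"
    and eq: "block_join i j \<alpha> \<beta> = block_join i j \<alpha>' \<beta>'"
  shows "\<alpha> = \<alpha>'" "\<beta> = \<beta>'"
proof -
  have "\<alpha> k = \<alpha>' k" for k
  proof (cases "k \<in> {1..i}")
    case True
    then show ?thesis using fun_cong[OF eq, of k] by (simp add: block_join_left)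
  next
    case False
    then show ?thesis using \<alpha> by (simp add: permutes_not_in)
  qed
  then show "\<alpha> = \<alpha>'" ..
  have "\<beta> k = \<beta>' k" for k
  proof (cases "k \<in> {1..j}")
    case True
    then show ?thesis
      using fun_cong[OF eq, of "Suc i + k"] block_join_right[of k j i] by simp
  next
    case False
    then show ?thesis using \<beta> by (simp add: permutes_not_in)
  qed
  then show "\<beta> = \<beta>'" ..
qed

text \<open>
  The position of the maximum determines the two blocks. What needs proof is that the values of the
  right block are exactly \<open>1, ..., j\<close>.
\<close>
lemma S_132_split:
  assumes \<sigma>: "\<sigma> \<in> S_132 (Suc n)"
  obtains i j \<alpha> \<beta> where "i + j = n" "\<alpha> \<in> S_132 i" "\<beta> \<in> S_132 j" "\<sigma> = block_join i j \<alpha> \<beta>"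
proof -
  have perm: "\<sigma> permutes {1..Suc n}" and av: "avoids_132 (Suc n) \<sigma>"
    using \<sigma> by (auto simp: S_132_def)
  have inj: "\<sigma> x = \<sigma> y \<longleftrightarrow> x = y" for x y
    using permutes_inj[OF perm] by (simp add: inj_eq)
  have "Suc n \<in> \<sigma> ` {1..Suc n}" using permutes_image[OF perm] by simp
  then obtain p where p: "1 \<le> p" "p \<le> Suc n" "\<sigma> p = Suc n" by auto
  define i where "i = p - 1"
  define j where "j = n - i"
  have ij: "i + j = n" and max: "\<sigma> (Suc i) = Suc n" using p by (auto simp: i_def j_def)
  \<comment> \<open>An entry before the maximum that is smaller than one after it would be the 1 of a 132
    with the maximum as 3.\<close>
  have above: "\<sigma> l < \<sigma> k" if "1 \<le> k" "k \<le> i" "Suc i < l" "l \<le> Suc n" for k l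
  proof -
    have "\<sigma> l < Suc n"
      using permutes_interval_bounds(2)[OF perm, of l] that inj[of l "Suc i"] max by force
    then have "\<not> \<sigma> k < \<sigma> l"
      using av that max unfolding avoids_132_def
      by (metis less_Suc_eq_le)
    then show ?thesis using inj[of k l] that by force
  qed
  define R where "R = \<sigma> ` {Suc (Suc i)..Suc n}"
  have card_R: "card R = j"
    unfolding R_def using ij by (subst card_image) (auto simp: inj_on_def inj)
  have "R \<subseteq> {1..j}"
  proof
    fix r assume "r \<in> R"
    then obtain l where l: "Suc i < l" "l \<le> Suc n" "r = \<sigma> l"
      by (auto simp: R_def Suc_le_eq)
    \<comment> \<open>The values after the maximum form a down-set, and there are only j of them.\<close>
    have "{1..r} \<subseteq> R"
    proof
      fix s assume s: "s \<in> {1..r}"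
      have "r \<le> Suc n" using l permutes_interval_bounds(2)[OF perm, of l] by simp
      then have "s \<in> \<sigma> ` {1..Suc n}" using s permutes_image[OF perm] by simp
      then obtain k where k: "1 \<le> k" "k \<le> Suc n" "s = \<sigma> k" by auto
      have "\<not> k \<le> i" using above[of k l] k l s by auto
      moreover have "k \<noteq> Suc i"
      proof
        assume "k = Suc i"
        with k s max \<open>r \<le> Suc n\<close> have "\<sigma> l = \<sigma> (Suc i)" using l by auto
        then show False using l inj by simp
      qed
      ultimately show "s \<in> R" using k by (auto simp: R_def)
    qed
    then have "card {1..r} \<le> card R" by (intro card_mono) (auto simp: R_def)
    moreover have "1 \<le> r" using l permutes_interval_bounds(1)[OF perm, of l] by simp
    ultimately show "r \<in> {1..j}" using card_R by simp
  qed
  then have R: "R = {1..j}" using card_R by (intro card_subset_eq) auto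
  have right_bounds: "1 \<le> \<sigma> (Suc i + m) \<and> \<sigma> (Suc i + m) \<le> j" if "1 \<le> m" "m \<le> j" for m
  proof -
    have "\<sigma> (Suc i + m) \<in> R" unfolding R_def using that ij by (intro imageI) auto
    then show ?thesis using R by simp
  qed
  have left_bounds: "j < \<sigma> k \<and> \<sigma> k \<le> n" if "1 \<le> k" "k \<le> i" for k
  proof -
    have "\<sigma> k \<notin> R" using that inj by (auto simp: R_def)
    moreover have "1 \<le> \<sigma> k" "\<sigma> k \<le> Suc n"
      using permutes_interval_bounds[OF perm, of k] that ij by auto
    moreover have "\<sigma> k \<noteq> Suc n" using inj[of k "Suc i"] max that by auto
    ultimately show ?thesis using R by auto
  qed
  define \<alpha> where "\<alpha> k = (if k \<in> {1..i} then \<sigma> k - j else k)" for k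
  define \<beta> where "\<beta> m = (if m \<in> {1..j} then \<sigma> (Suc i + m) else m)" for m
  have "\<alpha> permutes {1..i}"
  proof (rule inj_imp_permutes)
    show "inj_on \<alpha> {1..i}"
    proof (rule inj_onI)
      fix x y assume xy: "x \<in> {1..i}" "y \<in> {1..i}" "\<alpha> x = \<alpha> y"
      then have "\<sigma> x - j = \<sigma> y - j" "j < \<sigma> x" "j < \<sigma> y"
        using left_bounds[of x] left_bounds[of y] by (simp_all add: \<alpha>_def)
      then have "\<sigma> x = \<sigma> y" by linarith
      then show "x = y" by (simp add: inj)
    qed
    show "\<alpha> x \<in> {1..i}" if "x \<in> {1..i}" for x
      using that left_bounds[of x] ij by (auto simp: \<alpha>_def)
  qed (auto simp: \<alpha>_def)
  moreover have "avoids_132 i \<alpha>"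
  proof -
    have False if "1 \<le> u" "u < v" "v < w" "w \<le> i" "\<alpha> u < \<alpha> w" "\<alpha> w < \<alpha> v" for u v w
    proof -
      have "\<sigma> u - j < \<sigma> w - j" "\<sigma> w - j < \<sigma> v - j"
        using that by (simp_all add: \<alpha>_def)
      then have "\<sigma> u < \<sigma> w" "\<sigma> w < \<sigma> v" by linarith+
      moreover have "w \<le> Suc n" using that ij by simp
      ultimately show False using av that unfolding avoids_132_def by blast
    qed
    then show ?thesis unfolding avoids_132_def by blast
  qed
  moreover have "\<beta> permutes {1..j}"
  proof (rule inj_imp_permutes)
    show "inj_on \<beta> {1..j}" by (auto simp: inj_on_def \<beta>_def inj)
    show "\<beta> x \<in> {1..j}" if "x \<in> {1..j}" for x
      using that right_bounds[of x] by (auto simp: \<beta>_def)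
  qed (auto simp: \<beta>_def)
  moreover have "avoids_132 j \<beta>"
  proof -
    have False if "1 \<le> u" "u < v" "v < w" "w \<le> j" "\<beta> u < \<beta> w" "\<beta> w < \<beta> v" for u v w
    proof -
      have "\<sigma> (Suc i + u) < \<sigma> (Suc i + w)" "\<sigma> (Suc i + w) < \<sigma> (Suc i + v)"
        using that by (auto simp: \<beta>_def)
      moreover have "1 \<le> Suc i + u" "Suc i + u < Suc i + v" "Suc i + v < Suc i + w"
        "Suc i + w \<le> Suc n" using that ij by auto
      ultimately show False using av unfolding avoids_132_def by blast
    qed
    then show ?thesis unfolding avoids_132_def by blast
  qed
  moreover have "\<sigma> = block_join i j \<alpha> \<beta>"
  proof
    fix k
    show "\<sigma> k = block_join i j \<alpha> \<beta> k"
    proof (cases "k \<in> {1..Suc n}")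
      case True
      then have k: "1 \<le> k" "k \<le> Suc (i + j)" using ij by auto
      then show ?thesis
      proof (cases rule: block_positions_cases)
        case 1
        then show ?thesis using k left_bounds[of k] by (simp add: block_join_left \<alpha>_def)
      next
        case 2
        then show ?thesis using max ij by (simp add: block_join_max)
      next
        case (3 m)
        then show ?thesis using block_join_right[of m j i \<alpha> \<beta>] by (simp add: \<beta>_def)
      qed
    next
      case False
      then show ?thesis using permutes_not_in[OF perm False] ij
        by (auto simp: block_join_def)
    qed
  qed
  ultimately show thesis using that[of i j \<alpha> \<beta>] ij by (simp add: S_132_def)
qed

lemma bij_betw_block_join:
  "bij_betw (\<lambda>(i, \<alpha>, \<beta>). block_join i (n - i) \<alpha> \<beta>)
     (SIGMA i:{..n}. S_132 i \<times> S_132 (n - i)) (S_132 (Suc n))"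
  unfolding bij_betw_def
proof
  show "inj_on (\<lambda>(i, \<alpha>, \<beta>). block_join i (n - i) \<alpha> \<beta>)
     (SIGMA i:{..n}. S_132 i \<times> S_132 (n - i))"
  proof -
    have "(i, \<alpha>, \<beta>) = (i', \<alpha>', \<beta>')" if le: "i \<le> n" "i' \<le> n"
      and mem: "\<alpha> \<in> S_132 i" "\<beta> \<in> S_132 (n - i)" "\<alpha>' \<in> S_132 i'" "\<beta>' \<in> S_132 (n - i')"
      and eq: "block_join i (n - i) \<alpha> \<beta> = block_join i' (n - i') \<alpha>' \<beta>'"
    for i \<alpha> \<beta> i' \<alpha>' \<beta>'
    proof -
      have perm: "block_join i (n - i) \<alpha> \<beta> permutes {1..Suc n}"
        using block_join_in_S_132[OF mem(1,2)] le by (simp add: S_132_def)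
      have "block_join i (n - i) \<alpha> \<beta> (Suc i) = block_join i (n - i) \<alpha> \<beta> (Suc i')"
        by (subst (2) eq) (simp add: block_join_max le)
      then have "i = i'" using permutes_inj[OF perm] by (simp add: inj_eq)
      moreover from this have "\<alpha> = \<alpha>'" "\<beta> = \<beta>'"
        using block_join_eqD[of \<alpha> i \<alpha>' \<beta> "n - i" \<beta>'] mem eq by (simp_all add: S_132_def)
      ultimately show ?thesis by simp
    qed
    then show ?thesis by (auto simp: inj_on_def)
  qed
  show "(\<lambda>(i, \<alpha>, \<beta>). block_join i (n - i) \<alpha> \<beta>) `
     (SIGMA i:{..n}. S_132 i \<times> S_132 (n - i)) = S_132 (Suc n)" (is "?f ` ?A = _")
  proof (intro equalityI subsetI)
    fix \<sigma> assume "\<sigma> \<in> ?f ` ?A"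
    then obtain i \<alpha> \<beta> where "i \<le> n" "\<alpha> \<in> S_132 i" "\<beta> \<in> S_132 (n - i)"
      "\<sigma> = block_join i (n - i) \<alpha> \<beta>" by auto
    then show "\<sigma> \<in> S_132 (Suc n)" using block_join_in_S_132[of \<alpha> i \<beta> "n - i"] by simp
  next
    fix \<sigma> assume "\<sigma> \<in> S_132 (Suc n)"
    then obtain i j \<alpha> \<beta> where *: "i + j = n" "\<alpha> \<in> S_132 i" "\<beta> \<in> S_132 j"
      "\<sigma> = block_join i j \<alpha> \<beta>" by (rule S_132_split)
    then have "(i, \<alpha>, \<beta>) \<in> ?A" "\<sigma> = ?f (i, \<alpha>, \<beta>)" by auto
    then show "\<sigma> \<in> ?f ` ?A" by (rule rev_image_eqI)
  qed
qed

lemma finite_S_132: "finite (S_132 n)"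
  by (rule finite_subset[OF _ finite_permutations[of "{1..n}"]]) (auto simp: S_132_def)

lemma sum_S_132_Suc:
  fixes f :: "(nat \<Rightarrow> nat) \<Rightarrow> 'a::comm_monoid_add"
  shows "sum f (S_132 (Suc n)) =
    (\<Sum>i\<le>n. \<Sum>\<alpha>\<in>S_132 i. \<Sum>\<beta>\<in>S_132 (n - i). f (block_join i (n - i) \<alpha> \<beta>))"
proof -
  have "sum f (S_132 (Suc n)) =
      (\<Sum>(i, \<alpha>, \<beta>)\<in>(SIGMA i:{..n}. S_132 i \<times> S_132 (n - i)). f (block_join i (n - i) \<alpha> \<beta>))"
    using sum.reindex_bij_betw[OF bij_betw_block_join, of f n]
    by (simp add: case_prod_unfold)
  also have "\<dots> = (\<Sum>i\<le>n. \<Sum>(\<alpha>, \<beta>)\<in>S_132 i \<times> S_132 (n - i). f (block_join i (n - i) \<alpha> \<beta>))"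
    by (subst sum.Sigma) (auto simp: finite_S_132)
  finally show ?thesis by (simp add: sum.cartesian_product)
qed

section \<open>Pattern matches in the two blocks\<close>

text \<open>
  Both the number of matches and the number of entries in each quadrant count positions of a joined
  permutation; this lemma reduces all of them to counts within the blocks.
\<close>
lemma card_block_positions:
  "card {k \<in> {1..Suc (i + j)}. P k} =
     card {k \<in> {1..i}. P k} + (if P (Suc i) then 1 else 0)
       + card {m \<in> {1..j}. P (Suc i + m)}"
proof -
  have "{k \<in> {1..Suc (i + j)}. P k} =
      {k \<in> {1..i}. P k} \<union> (if P (Suc i) then {Suc i} else {}) \<union> (+) (Suc i) ` {m \<in> {1..j}. P (Suc i + m)}"
    (is "_ = ?A \<union> ?B \<union> ?C")
  proof (intro equalityI subsetI)
    fix k assume "k \<in> {k \<in> {1..Suc (i + j)}. P k}"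
    then have k: "1 \<le> k" "k \<le> Suc (i + j)" "P k" by auto
    from k(1,2) show "k \<in> ?A \<union> ?B \<union> ?C"
      by (cases rule: block_positions_cases) (use k in auto)
  qed (auto split: if_splits)
  then have "card {k \<in> {1..Suc (i + j)}. P k} = card (?A \<union> ?B \<union> ?C)"
    by (rule arg_cong)
  moreover have "card (?A \<union> ?B \<union> ?C) = card (?A \<union> ?B) + card ?C"
    by (rule card_Un_disjoint) auto
  moreover have "card (?A \<union> ?B) = card ?A + card ?B"
  proof (rule card_Un_disjoint)
    have "Suc i \<notin> ?A" by simp
    then show "?A \<inter> ?B = {}" by simp
  qed simp_all
  moreover have "card ?B = (if P (Suc i) then 1 else 0)"
    by simp
  moreover have "card ?C = card {m \<in> {1..j}. P (Suc i + m)}"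
    by (rule card_image) simp
  ultimately show ?thesis by (simp only:)
qed

text \<open>
  For a position in either block the four quadrant counts are those within the block, plus the
  contribution of the other block and of the maximum: a position on the left gains 1 in the first
  quadrant and \<open>j\<close> in the fourth, and a position on the right gains \<open>i + 1\<close> in the second.
  Subtracting these gains from the thresholds, truncated at 0, gives the parameters for the blocks.
\<close>
lemma mmp_block_join:
  assumes \<alpha>: "\<alpha> permutes {1..i}" and \<beta>: "\<beta> permutes {1..j}" and a: "a \<ge> 1"
  shows "mmp a b c d (Suc (i + j)) (block_join i j \<alpha> \<beta>) =
    mmp (a - 1) b c (d - j) i \<alpha> + mmp a (b - 1 - i) c d j \<beta>"
proof -
  let ?f = "block_join i j \<alpha> \<beta>"
  let ?M = "matches_MMP a b c d (Suc (i + j)) ?f"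
  note b\<alpha> = permutes_interval_bounds[OF \<alpha>]
  note b\<beta> = permutes_interval_bounds[OF \<beta>]
  have fr: "?f (Suc (i + m)) = \<beta> m" if "1 \<le> m" "m \<le> j" for m
    using block_join_right[of m j i] that by simp
  have card_all: "card {m \<in> {1..N}. P m} = N" if "\<And>m. 1 \<le> m \<Longrightarrow> m \<le> N \<Longrightarrow> P m" for N P
  proof -
    have "{m \<in> {1..N}. P m} = {1..N}" using that by auto
    then show ?thesis by simp
  qed
  have card_none: "card {m \<in> {1..N}. P m} = 0" if "\<And>m. 1 \<le> m \<Longrightarrow> m \<le> N \<Longrightarrow> \<not> P m"
    for N and P :: "nat \<Rightarrow> bool"
  proof -
    have "{m \<in> {1..N}. P m} = {}" using that by auto
    then show ?thesis by (simp only: card.empty)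
  qed
  have card_cong: "card {m \<in> {1..N}. P m} = card {m \<in> {1..N}. P' m}"
    if "\<And>m. 1 \<le> m \<Longrightarrow> m \<le> N \<Longrightarrow> P m \<longleftrightarrow> P' m" for N and P P' :: "nat \<Rightarrow> bool"
  proof -
    have "{m \<in> {1..N}. P m} = {m \<in> {1..N}. P' m}" using that by auto
    then show ?thesis by simp
  qed
  have left: "?M k \<longleftrightarrow> matches_MMP (a - 1) b c (d - j) i \<alpha> k" if k: "1 \<le> k" "k \<le> i" for k
  proof -
    have fk: "?f k = \<alpha> k + j" "1 \<le> \<alpha> k" "\<alpha> k \<le> i" using k b\<alpha>[of k] by (auto simp: block_join_left)
    have I: "card {l \<in> {1..Suc (i + j)}. k < l \<and> ?f k < ?f l} =
        card {l \<in> {1..i}. k < l \<and> \<alpha> k < \<alpha> l} + 1"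
    proof -
      have "card {l \<in> {1..i}. k < l \<and> ?f k < ?f l} = card {l \<in> {1..i}. k < l \<and> \<alpha> k < \<alpha> l}"
        by (rule card_cong) (simp add: block_join_left fk(1))
      moreover have "card {m \<in> {1..j}. k < Suc i + m \<and> ?f k < ?f (Suc i + m)} = 0"
        by (rule card_none) (use fk b\<beta>(2) in \<open>fastforce simp: fr\<close>)
      ultimately show ?thesis
        unfolding card_block_positions using k fk by (simp add: block_join_max)
    qed
    have II: "card {l \<in> {1..Suc (i + j)}. l < k \<and> ?f k < ?f l} =
        card {l \<in> {1..i}. l < k \<and> \<alpha> k < \<alpha> l}"
    proof -
      have "card {l \<in> {1..i}. l < k \<and> ?f k < ?f l} = card {l \<in> {1..i}. l < k \<and> \<alpha> k < \<alpha> l}"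
        by (rule card_cong) (simp add: block_join_left fk(1))
      moreover have "card {m \<in> {1..j}. Suc i + m < k \<and> ?f k < ?f (Suc i + m)} = 0"
        by (rule card_none) (use k in simp)
      ultimately show ?thesis
        unfolding card_block_positions using k by simp
    qed
    have III: "card {l \<in> {1..Suc (i + j)}. l < k \<and> ?f l < ?f k} =
        card {l \<in> {1..i}. l < k \<and> \<alpha> l < \<alpha> k}"
    proof -
      have "card {l \<in> {1..i}. l < k \<and> ?f l < ?f k} = card {l \<in> {1..i}. l < k \<and> \<alpha> l < \<alpha> k}"
        by (rule card_cong) (simp add: block_join_left fk(1))
      moreover have "card {m \<in> {1..j}. Suc i + m < k \<and> ?f (Suc i + m) < ?f k} = 0"
        by (rule card_none) (use k in simp)
      ultimately show ?thesis
        unfolding card_block_positions using k by simp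
    qed
    have IV: "card {l \<in> {1..Suc (i + j)}. k < l \<and> ?f l < ?f k} =
        card {l \<in> {1..i}. k < l \<and> \<alpha> l < \<alpha> k} + j"
    proof -
      have "card {l \<in> {1..i}. k < l \<and> ?f l < ?f k} = card {l \<in> {1..i}. k < l \<and> \<alpha> l < \<alpha> k}"
        by (rule card_cong) (simp add: block_join_left fk(1))
      moreover have "card {m \<in> {1..j}. k < Suc i + m \<and> ?f (Suc i + m) < ?f k} = j"
        by (rule card_all) (use k fk b\<beta>(2) in \<open>fastforce simp: fr\<close>)
      ultimately show ?thesis
        unfolding card_block_positions using k fk by (simp add: block_join_max)
    qed
    show ?thesis unfolding matches_MMP_def I II III IV using a by auto
  qed
  have top: "\<not> ?M (Suc i)"
  proof -
    have "card {l \<in> {1..Suc (i + j)}. Suc i < l \<and> ?f (Suc i) < ?f l} = 0"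
    proof (rule card_none)
      fix l assume "1 \<le> l" "l \<le> Suc (i + j)"
      then have "?f l \<le> ?f (Suc i)"
        unfolding block_join_max
        by (rule permutes_interval_bounds(2)[OF block_join_permutes[OF \<alpha> \<beta>]])
      then show "\<not> (Suc i < l \<and> ?f (Suc i) < ?f l)" by simp
    qed
    then show ?thesis unfolding matches_MMP_def using a by (simp only: not_le) simp
  qed
  have right: "?M (Suc i + m) \<longleftrightarrow> matches_MMP a (b - 1 - i) c d j \<beta> m" if m: "1 \<le> m" "m \<le> j" for m
  proof -
    have fm: "?f (Suc i + m) = \<beta> m" "1 \<le> \<beta> m" "\<beta> m \<le> j" using m b\<beta>[of m] fr by auto
    have I: "card {l \<in> {1..Suc (i + j)}. Suc i + m < l \<and> ?f (Suc i + m) < ?f l} =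
        card {l \<in> {1..j}. m < l \<and> \<beta> m < \<beta> l}"
    proof -
      have "card {l \<in> {1..i}. Suc i + m < l \<and> ?f (Suc i + m) < ?f l} = 0"
        by (rule card_none) simp
      moreover have "card {l \<in> {1..j}. Suc i + m < Suc i + l \<and> ?f (Suc i + m) < ?f (Suc i + l)} =
          card {l \<in> {1..j}. m < l \<and> \<beta> m < \<beta> l}"
        by (rule card_cong) (simp add: fr fr[OF m])
      ultimately show ?thesis
        unfolding card_block_positions by simp
    qed
    have II: "card {l \<in> {1..Suc (i + j)}. l < Suc i + m \<and> ?f (Suc i + m) < ?f l} =
        card {l \<in> {1..j}. l < m \<and> \<beta> m < \<beta> l} + Suc i"
    proof -
      have "card {l \<in> {1..i}. l < Suc i + m \<and> ?f (Suc i + m) < ?f l} = i"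
        by (rule card_all) (use fm b\<alpha>(1) in \<open>fastforce simp: block_join_left\<close>)
      moreover have "card {l \<in> {1..j}. Suc i + l < Suc i + m \<and> ?f (Suc i + m) < ?f (Suc i + l)} =
          card {l \<in> {1..j}. l < m \<and> \<beta> m < \<beta> l}"
        by (rule card_cong) (simp add: fr fr[OF m])
      ultimately show ?thesis
        unfolding card_block_positions using m fm by (simp add: block_join_max)
    qed
    have III: "card {l \<in> {1..Suc (i + j)}. l < Suc i + m \<and> ?f l < ?f (Suc i + m)} =
        card {l \<in> {1..j}. l < m \<and> \<beta> l < \<beta> m}"
    proof -
      have "card {l \<in> {1..i}. l < Suc i + m \<and> ?f l < ?f (Suc i + m)} = 0"
        by (rule card_none) (use fm in \<open>simp add: block_join_left\<close>)
      moreover have "card {l \<in> {1..j}. Suc i + l < Suc i + m \<and> ?f (Suc i + l) < ?f (Suc i + m)} =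
          card {l \<in> {1..j}. l < m \<and> \<beta> l < \<beta> m}"
        by (rule card_cong) (simp add: fr fr[OF m])
      ultimately show ?thesis
        unfolding card_block_positions using m fm by (simp add: block_join_max)
    qed
    have IV: "card {l \<in> {1..Suc (i + j)}. Suc i + m < l \<and> ?f l < ?f (Suc i + m)} =
        card {l \<in> {1..j}. m < l \<and> \<beta> l < \<beta> m}"
    proof -
      have "card {l \<in> {1..i}. Suc i + m < l \<and> ?f l < ?f (Suc i + m)} = 0"
        by (rule card_none) simp
      moreover have "card {l \<in> {1..j}. Suc i + m < Suc i + l \<and> ?f (Suc i + l) < ?f (Suc i + m)} =
          card {l \<in> {1..j}. m < l \<and> \<beta> l < \<beta> m}"
        by (rule card_cong) (simp add: fr fr[OF m])
      ultimately show ?thesis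
        unfolding card_block_positions by simp
    qed
    show ?thesis unfolding matches_MMP_def I II III IV by auto
  qed
  have "card {k \<in> {1..i}. ?M k} = mmp (a - 1) b c (d - j) i \<alpha>"
    unfolding mmp_def by (rule card_cong) (rule left)
  moreover have "card {m \<in> {1..j}. ?M (Suc i + m)} = mmp a (b - 1 - i) c d j \<beta>"
    unfolding mmp_def by (rule card_cong) (rule right)
  ultimately show ?thesis
    using top unfolding mmp_def[of a b c d "Suc (i + j)"] card_block_positions by simp
qed

lemma Qn_132_Suc:
  assumes "a \<ge> 1"
  shows "Qn_132 a b c d (Suc n) =
    (\<Sum>i\<le>n. Qn_132 (a - 1) b c (d - (n - i)) i * Qn_132 a (b - 1 - i) c d (n - i))"
  unfolding Qn_132_def sum_S_132_Suc
proof (rule sum.cong[OF refl])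
  fix i assume "i \<in> {..n}"
  then have i: "i + (n - i) = n" by simp
  let ?p = "mmp (a - 1) b c (d - (n - i)) i" and ?q = "mmp a (b - 1 - i) c d (n - i)"
  have "monom 1 (mmp a b c d (Suc n) (block_join i (n - i) \<alpha> \<beta>)) =
      (monom 1 (?p \<alpha>) * monom 1 (?q \<beta>) :: int poly)"
    if "\<alpha> \<in> S_132 i" "\<beta> \<in> S_132 (n - i)" for \<alpha> \<beta>
    using mmp_block_join[of \<alpha> i \<beta> "n - i" a b c d] that assms i
    by (simp add: S_132_def mult_monom)
  then show "(\<Sum>\<alpha>\<in>S_132 i. \<Sum>\<beta>\<in>S_132 (n - i).
        monom 1 (mmp a b c d (Suc n) (block_join i (n - i) \<alpha> \<beta>))) =
      (\<Sum>\<alpha>\<in>S_132 i. monom 1 (?p \<alpha>)) * (\<Sum>\<beta>\<in>S_132 (n - i). monom 1 (?q \<beta>) :: int poly)"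
    by (simp add: sum_product)
qed

section \<open>Counting 132-avoiding permutations\<close>

lemma catalan_Suc: "(n + 2) * catalan (Suc n) = (4 * n + 2) * catalan n"
proof -
  have 1: "Suc n * (Suc (2 * n) choose Suc n) = Suc (2 * n) * (2 * n choose n)"
    by (rule Suc_times_binomial)
  have 2: "Suc n * (Suc (Suc (2 * n)) choose Suc n) =
      Suc (Suc (2 * n)) * (Suc (2 * n) choose n)"
    by (rule Suc_times_binomial)
  have 3: "Suc (2 * n) choose n = Suc (2 * n) choose Suc n"
    using binomial_symmetric[of n "Suc (2 * n)"] by (simp add: Suc_diff_le)
  have "Suc n * (Suc n * ((n + 2) * catalan (Suc n))) =
      Suc n * (Suc n * (Suc (Suc (2 * n)) choose Suc n))"
    using Suc_times_catalan[of "Suc n"] by simp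
  also have "\<dots> = Suc (Suc (2 * n)) * (Suc n * (Suc (2 * n) choose Suc n))"
    unfolding 2 3 by (simp only: ac_simps)
  also have "\<dots> = Suc (Suc (2 * n)) * Suc (2 * n) * (Suc n * catalan n)"
    unfolding 1 using Suc_times_catalan[of n] by (simp only: ac_simps Suc_eq_plus1)
  also have "\<dots> = Suc n * (Suc n * ((4 * n + 2) * catalan n))"
    by (simp add: algebra_simps)
  finally show ?thesis by (simp only: mult_cancel1 nat.distinct simp_thms)
qed

text \<open>
  The generating function satisfies \<open>F = 1 + X F\<^sup>2\<close>, so \<open>D = 1 - 2 X F\<close> is a square root of
  \<open>1 - 4 X\<close>. Differentiating \<open>D\<^sup>2\<close> and multiplying by \<open>D\<close> gives the linear differential equation
  \<open>(1 - 4 X) D' = - 2 D\<close>, whose coefficients are the two-term recurrence of \<open>catalan_Suc\<close>. It never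
  leaves the power series over the integers, since no square root has to be constructed.
\<close>
lemma catalan_of_convolution:
  fixes s :: "nat \<Rightarrow> nat"
  assumes s0: "s 0 = 1" and s_Suc: "\<And>n. s (Suc n) = (\<Sum>i\<le>n. s i * s (n - i))"
  shows "s n = catalan n"
proof (induction n)
  case 0
  then show ?case using s0 by (simp add: catalan_def)
next
  case (Suc n)
  define F :: "int fps" where "F = Abs_fps (\<lambda>n. int (s n))"
  define D where "D = 1 - 2 * fps_X * F"
  have F: "F = 1 + fps_X * (F * F)"
  proof (rule fps_ext)
    fix m
    have "fps_nth (F * F) k = int (s (Suc k))" for k
      by (simp add: F_def s_Suc fps_mult_nth atLeast0AtMost)
    then show "fps_nth F m = fps_nth (1 + fps_X * (F * F)) m"
      by (cases m) (simp_all add: F_def s0)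
  qed
  have "D * D = 1 - 4 * fps_X * (F - fps_X * (F * F))"
    unfolding D_def by (simp add: algebra_simps)
  also have "F - fps_X * (F * F) = 1" using F by (metis add_diff_cancel_right')
  finally have sq: "D * D = 1 - 4 * fps_X" by simp
  have "2 * (D * fps_deriv D) = fps_deriv (D * D)" by (simp add: algebra_simps)
  also have "\<dots> = 2 * (- 2)" unfolding sq by simp
  finally have "D * fps_deriv D = - 2" by (subst (asm) mult_cancel_left) auto
  then have "(1 - 4 * fps_X) * fps_deriv D = D * (- 2)"
    unfolding sq[symmetric] by (simp only: mult.assoc)
  then have "fps_nth ((1 - 4 * fps_X) * fps_deriv D) (Suc n) = fps_nth (D * (- 2)) (Suc n)"
    by simp
  moreover have D_nth: "fps_nth D (Suc m) = - 2 * int (s m)" for m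
    by (simp add: D_def F_def mult.assoc numeral_fps_const)
  ultimately have "int (n + 2) * int (s (Suc n)) = int (4 * n + 2) * int (s n)"
    by (simp add: left_diff_distrib mult.assoc numeral_fps_const algebra_simps)
  then have "(n + 2) * s (Suc n) = (4 * n + 2) * s n"
    by (metis of_nat_eq_iff of_nat_mult)
  also have "\<dots> = (n + 2) * catalan (Suc n)" using Suc.IH catalan_Suc[of n] by simp
  finally show ?case by (simp only: mult_cancel1) simp
qed

lemma S_132_0: "S_132 0 = {id}"
  by (auto simp: S_132_def avoids_132_def)

lemma card_S_132: "card (S_132 n) = catalan n"
proof (rule catalan_of_convolution)
  show "card (S_132 0) = 1" by (simp add: S_132_0)
  show "card (S_132 (Suc n)) = (\<Sum>i\<le>n. card (S_132 i) * card (S_132 (n - i)))" for n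
    using sum_S_132_Suc[of "\<lambda>_. 1::nat" n] by simp
qed

section \<open>The generating function\<close>

text \<open>
  The second and fourth quadrants of a position are disjoint and omit the position itself, so a
  match needs more than \<open>b + d\<close> positions.
\<close>
lemma Qn_132_small:
  assumes "n \<le> b + d"
  shows "Qn_132 a b c d n = of_nat (catalan n)"
proof -
  have "\<not> matches_MMP a b c d n \<sigma> i" if i: "i \<in> {1..n}" for \<sigma> i
  proof
    assume "matches_MMP a b c d n \<sigma> i"
    then have "b + d \<le> card {j \<in> {1..n}. j < i \<and> \<sigma> i < \<sigma> j} + card {j \<in> {1..n}. i < j \<and> \<sigma> j < \<sigma> i}"
      unfolding matches_MMP_def by simp
    also have "\<dots> = card ({j \<in> {1..n}. j < i \<and> \<sigma> i < \<sigma> j} \<union> {j \<in> {1..n}. i < j \<and> \<sigma> j < \<sigma> i})"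
      by (rule card_Un_disjoint[symmetric]) auto
    also have "\<dots> \<le> card ({1..n} - {i})" by (rule card_mono) auto
    also have "\<dots> < n" using i by simp
    finally show False using assms by simp
  qed
  then have "mmp a b c d n \<sigma> = 0" for \<sigma>
    unfolding mmp_def by auto
  then show ?thesis
    unfolding Qn_132_def by (simp add: card_S_132 monom_0 one_pCons[symmetric])
qed

lemma fps_nth_Q_132: "fps_nth (Q_132 a b c d) n = Qn_132 a b c d n"
  using Qn_132_small[of 0 b d a c] by (simp add: Q_132_def catalan_def)

lemma fps_nth_catalan_sum:
  "fps_nth (\<Sum>p<m. catalan_term p) n = (if n < m then of_nat (catalan n) else 0)"
proof -
  have "fps_nth (\<Sum>p<m. catalan_term p) n =
      (\<Sum>p<m. if p = n then of_nat (catalan p) else 0)"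
    unfolding fps_sum_nth
    by (rule sum.cong) (auto simp: catalan_term_def fps_of_nat[symmetric])
  then show ?thesis by simp
qed

text \<open>
  Every difference in the theorem has this form: the Catalan sum cancels coefficients in
  the range of \<open>Qn_132_small\<close>, so subtracting it only truncates the series from below.
\<close>
lemma fps_nth_Q_132_tail:
  assumes "m \<le> b + d + 1"
  shows "fps_nth (Q_132 a b c d - (\<Sum>p<m. catalan_term p)) n =
    (if n < m then 0 else Qn_132 a b c d n)"
  using assms by (auto simp: fps_nth_Q_132 fps_nth_catalan_sum Qn_132_small)

lemma fps_nth_catalan_term_mult:
  "fps_nth (catalan_term i * F) n = (if n < i then 0 else of_nat (catalan i) * fps_nth F (n - i))"
  by (simp add: catalan_term_def fps_of_nat[symmetric] mult.assoc fps_X_power_mult_nth)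

theorem theorem16:
  fixes a b c d :: nat
  assumes "a \<ge> 1" "b \<ge> 1" "c \<ge> 1" "d \<ge> 1"
  shows "Q_132 a b c d =
      (\<Sum>p<b + d. catalan_term p)
    + fps_X * (\<Sum>i<b - 1. catalan_term i *
        (Q_132 a (b - 1 - i) c d - (\<Sum>r<b - i + d - 1. catalan_term r)))
    + fps_X * (Q_132 (a - 1) b c 0 - (\<Sum>i<b - 1. catalan_term i))
            * (Q_132 a 0 c d - (\<Sum>j<d. catalan_term j))
    + fps_X * (\<Sum>j<d. catalan_term j *
        (Q_132 (a - 1) b c (d - j) - (\<Sum>s<b + d - j - 1. catalan_term s)))"
  (is "_ = ?P + fps_X * ?U + fps_X * ?V1 * ?V2 + fps_X * ?W")
proof (rule fps_ext)
  fix n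
  show "fps_nth (Q_132 a b c d) n =
    fps_nth (?P + fps_X * ?U + fps_X * ?V1 * ?V2 + fps_X * ?W) n"
  proof (cases n)
    case 0
    then show ?thesis
      using assms Qn_132_small[of 0 b d a c]
      by (simp add: fps_nth_Q_132 fps_nth_catalan_sum mult.assoc)
  next
    case (Suc m)
    \<comment> \<open>The two factors of the summand with left block of size i in the recurrence.\<close>
    let ?L = "\<lambda>i. Qn_132 (a - 1) b c (d - (m - i)) i"
    let ?R = "\<lambda>i. Qn_132 a (b - 1 - i) c d (m - i)"
    have U: "fps_nth ?U m =
        (\<Sum>i<b - 1. if m + 1 < b + d then 0 else of_nat (catalan i) * ?R i)"
      unfolding fps_sum_nth
    proof (rule sum.cong[OF refl])
      fix i assume "i \<in> {..<b - 1}"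
      then have i: "i < b - 1" by simp
      have "b - i + d - 1 \<le> b - 1 - i + d + 1" using i by simp
      note tail = fps_nth_Q_132_tail[OF this, of a c "m - i"]
      show "fps_nth (catalan_term i *
          (Q_132 a (b - 1 - i) c d - (\<Sum>r<b - i + d - 1. catalan_term r))) m =
        (if m + 1 < b + d then 0 else of_nat (catalan i) * ?R i)"
        unfolding fps_nth_catalan_term_mult tail using i by auto
    qed
    have V: "fps_nth (?V1 * ?V2) m =
        (\<Sum>i\<le>m. (if i < b - 1 then 0 else Qn_132 (a - 1) b c 0 i)
          * (if m - i < d then 0 else Qn_132 a 0 c d (m - i)))"
    proof -
      have "b - 1 \<le> b + 0 + 1" "d \<le> 0 + d + 1" by auto
      note tails = this[THEN fps_nth_Q_132_tail]
      show ?thesis unfolding fps_mult_nth tails by (simp add: atLeast0AtMost)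
    qed
    have W: "fps_nth ?W m =
        (\<Sum>j<d. if m + 1 < b + d then 0
          else of_nat (catalan j) * Qn_132 (a - 1) b c (d - j) (m - j))"
      unfolding fps_sum_nth
    proof (rule sum.cong[OF refl])
      fix j assume "j \<in> {..<d}"
      then have j: "j < d" by simp
      have "b + d - j - 1 \<le> b + (d - j) + 1" using j by simp
      note tail = fps_nth_Q_132_tail[OF this, of "a - 1" c "m - j"]
      show "fps_nth (catalan_term j *
          (Q_132 (a - 1) b c (d - j) - (\<Sum>s<b + d - j - 1. catalan_term s))) m =
        (if m + 1 < b + d then 0
          else of_nat (catalan j) * Qn_132 (a - 1) b c (d - j) (m - j))"
        unfolding fps_nth_catalan_term_mult tail using j assms(2) by auto
    qed
    have rhs: "fps_nth (?P + fps_X * ?U + fps_X * ?V1 * ?V2 + fps_X * ?W) n =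
        (if n < b + d then of_nat (catalan n) else 0)
          + fps_nth ?U m + fps_nth (?V1 * ?V2) m + fps_nth ?W m"
      by (simp add: Suc fps_nth_catalan_sum mult.assoc)
    show ?thesis
    proof (cases "n < b + d")
      case True
      have "fps_nth (?V1 * ?V2) m = 0"
        unfolding V using True Suc by (intro sum.neutral) auto
      then show ?thesis
        unfolding rhs U W using True Suc by (simp add: fps_nth_Q_132 Qn_132_small)
    next
      case False
      then have m: "b + d \<le> m + 1" using Suc by simp
      have U': "fps_nth ?U m = (\<Sum>i\<le>m. if i < b - 1 then of_nat (catalan i) * ?R i else 0)"
      proof -
        have "{i \<in> {..m}. i < b - 1} = {..<b - 1}" using m by auto
        then show ?thesis
          unfolding U using m by (simp add: sum.inter_filter[symmetric])
      qed
      have W': "fps_nth ?W m =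
          (\<Sum>i\<le>m. if m - i < d then of_nat (catalan (m - i)) * ?L i else 0)"
      proof -
        have "fps_nth ?W m = (\<Sum>j\<le>m. if j < d
            then of_nat (catalan j) * Qn_132 (a - 1) b c (d - j) (m - j) else 0)"
        proof -
          have "{j \<in> {..m}. j < d} = {..<d}" using m assms(2) by auto
          then show ?thesis
            unfolding W using m by (simp add: sum.inter_filter[symmetric])
        qed
        also have "\<dots> = (\<Sum>i\<le>m. if m - i < d then of_nat (catalan (m - i)) * ?L i else 0)"
          by (rule sum.reindex_bij_witness[of _ "\<lambda>i. m - i" "\<lambda>i. m - i"]) auto
        finally show ?thesis .
      qed
      have "fps_nth (Q_132 a b c d) n = (\<Sum>i\<le>m. ?L i * ?R i)"
        using Qn_132_Suc[OF assms(1)] by (simp add: fps_nth_Q_132 Suc)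
      also have "\<dots> = (\<Sum>i\<le>m. (if i < b - 1 then of_nat (catalan i) * ?R i else 0)
          + (if i < b - 1 then 0 else Qn_132 (a - 1) b c 0 i)
            * (if m - i < d then 0 else Qn_132 a 0 c d (m - i))
          + (if m - i < d then of_nat (catalan (m - i)) * ?L i else 0))"
      proof (rule sum.cong[OF refl])
        fix i assume "i \<in> {..m}"
        \<comment> \<open>A left block shorter than b - 1 and a right block shorter than d cannot occur together,
          because their sizes add up to m, which is at least b + d - 1.\<close>
        then consider "i < b - 1" "\<not> m - i < d" | "\<not> i < b - 1" "\<not> m - i < d"
          | "\<not> i < b - 1" "m - i < d" using m by fastforce
        then show "?L i * ?R i = (if i < b - 1 then of_nat (catalan i) * ?R i else 0)
          + (if i < b - 1 then 0 else Qn_132 (a - 1) b c 0 i)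
            * (if m - i < d then 0 else Qn_132 a 0 c d (m - i))
          + (if m - i < d then of_nat (catalan (m - i)) * ?L i else 0)"
        proof cases
          case 1
          then show ?thesis by (simp add: Qn_132_small)
        next
          case 2
          then show ?thesis by simp
        next
          case 3
          then show ?thesis by (simp add: Qn_132_small)
        qed
      qed
      also have "\<dots> = fps_nth ?U m + fps_nth (?V1 * ?V2) m + fps_nth ?W m"
        unfolding U' V W' by (simp add: sum.distrib)
      finally show ?thesis unfolding rhs using False by simp
    qed
  qed
qed

end
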